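(* Let $T$ be a tree. Then the one-point compactification $\alpha T$ is $2$-determined if and only if $T$ is $\mathbb{R}$-embeddable and $|T|\leq 2^{\aleph_0}$.
   Context: All topological spaces are Hausdorff. A tree is a partially ordered set $(T,<)$ with a minimum element $0$ such that for every $t\in T$ the set $[0,t)=\{x\in T: x<t\}$ is well ordered, and every two elements $s,t\in T$ have a greatest lower bound $s\wedge t$. $T$ carries the interval topology, generated by the sets $(s,t]=\{x\in T: s<x\leq t\}$ together with $\{0\}$; it is locally compact and every interval $[0,t]$ is compact and open. The one-point compactification is $\alpha T=T\cup\{\infty\}$, where $T$ is an open subspace and basic neighborhoods of $\infty$ are the sets $\alpha T\setminus\bigcup_{i<n}[0,t_i]$ with $n\in\omega$ and $t_0,\dots,t_{n-1}\in T$. A compact space $K$ is $n$-determined if there are a second countable space $S$ and an upper semicontinuous set-valued map $\Phi$ assigning to each $s\in S$ a subset $\Phi(s)\subseteq K$ with at most $n$ elements, such that $K=\bigcup_{s\in S}\Phi(s)$. (Upper semicontinuous: $\{s\in S:\Phi(s)\subseteq V\}$ is open for each open $V\subseteq K$.) For a linearly ordered set $X$, $T$ is $X$-embeddable if there is a function $f:T\to X$ with $f(s)<f(t)$ whenever $s<t$ in $T$ ($f$ need not be one-to-one). *)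

theory Defs
  imports "HOL-Analysis.Analysis"
begin

section \<open>Trees\<close>

definition is_tree :: "'a::order set \<Rightarrow> bool" where
  "is_tree T \<longleftrightarrow>
     (\<exists>r\<in>T. \<forall>t\<in>T. r \<le> t) \<and>
     (\<forall>t\<in>T. well_order_on {x \<in> T. x < t} {(x, y). x \<in> T \<and> y \<in> T \<and> x < t \<and> y < t \<and> x \<le> y}) \<and>
     (\<forall>s\<in>T. \<forall>t\<in>T. \<exists>m\<in>T. m \<le> s \<and> m \<le> t \<and> (\<forall>x\<in>T. x \<le> s \<and> x \<le> t \<longrightarrow> x \<le> m))"

definition tree_root :: "'a::order set \<Rightarrow> 'a" where
  "tree_root T = (LEAST x. x \<in> T)"

definition tree_topology :: "'a::order set \<Rightarrow> 'a topology" where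
  "tree_topology T =
     topology_generated_by (insert {tree_root T} {{x \<in> T. s < x \<and> x \<le> t} | s t. s \<in> T \<and> t \<in> T})"

definition embeddable_in :: "'a::order set \<Rightarrow> 'b::linorder set \<Rightarrow> bool" where
  "embeddable_in T X \<longleftrightarrow> (\<exists>f. f \<in> T \<rightarrow> X \<and> strict_mono_on T f)"


section \<open>Determined spaces\<close>

definition usc_set_valued :: "'b topology \<Rightarrow> 'a topology \<Rightarrow> ('b \<Rightarrow> 'a set) \<Rightarrow> bool" where
  "usc_set_valued S K \<Phi> \<longleftrightarrow>
     (\<forall>s \<in> topspace S. \<Phi> s \<subseteq> topspace K) \<and>
     (\<forall>V. openin K V \<longrightarrow> openin S {s \<in> topspace S. \<Phi> s \<subseteq> V})"

definition determines :: "nat \<Rightarrow> 'b topology \<Rightarrow> ('b \<Rightarrow> 'a set) \<Rightarrow> 'a topology \<Rightarrow> bool" where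
  "determines n S \<Phi> K \<longleftrightarrow>
     second_countable S \<and> Hausdorff_space S \<and> usc_set_valued S K \<Phi> \<and>
     (\<forall>s \<in> topspace S. finite (\<Phi> s) \<and> card (\<Phi> s) \<le> n) \<and>
     topspace K = (\<Union>s \<in> topspace S. \<Phi> s)"

text \<open>
  All spaces are Hausdorff by convention. HOL cannot quantify over the type of points of \<open>S\<close>
  inside a formula. A second countable Hausdorff space injects into the power set of \<open>\<nat>\<close> (a point
  goes to the set of indices of the basic open sets containing it), so letting \<open>S\<close> range over
  topologies on \<open>nat set\<close> covers every such space up to homeomorphism; the lemma
  \<open>n_determinedI\<close> below shows that spaces \<open>S\<close> over an arbitrary type give nothing new.
\<close>

definition n_determined :: "nat \<Rightarrow> 'a topology \<Rightarrow> bool" where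
  "n_determined n K \<longleftrightarrow>
     compact_space K \<and> Hausdorff_space K \<and>
     (\<exists>(S :: nat set topology) \<Phi>. determines n S \<Phi> K)"

lemma second_countable_Hausdorff_inj:
  assumes "second_countable S" "Hausdorff_space S"
  obtains c :: "'b \<Rightarrow> nat set" where "inj_on c (topspace S)"
proof -
  obtain \<B> where \<B>: "countable \<B>"
      "\<And>U x. openin S U \<Longrightarrow> x \<in> U \<Longrightarrow> \<exists>V \<in> \<B>. x \<in> V \<and> V \<subseteq> U"
    using assms(1) unfolding second_countable_def by metis
  define c where "c x = to_nat_on \<B> ` {V \<in> \<B>. x \<in> V}" for x
  have "x = y" if xy: "x \<in> topspace S" "y \<in> topspace S" "c x = c y" for x y
  proof (rule ccontr)
    assume "x \<noteq> y"
    then obtain U V where UV: "openin S U" "openin S V" "x \<in> U" "y \<in> V" "disjnt U V"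
      using assms(2) xy unfolding Hausdorff_space_def by metis
    then obtain W where W: "W \<in> \<B>" "x \<in> W" "W \<subseteq> U" using \<B>(2) by metis
    then have "to_nat_on \<B> W \<in> c y" using xy(3) unfolding c_def by blast
    then obtain W' where W': "W' \<in> \<B>" "y \<in> W'" "to_nat_on \<B> W = to_nat_on \<B> W'"
      unfolding c_def by blast
    then have "W = W'" using inj_on_to_nat_on[OF \<B>(1)] W(1) by (meson inj_onD)
    then show False using W W' UV by (auto simp: disjnt_def)
  qed
  then show thesis using that[of c] by (auto simp: inj_on_def)
qed

lemma n_determinedI:
  fixes S :: "'b topology" and K :: "'a topology"
  assumes "compact_space K" "Hausdorff_space K" "determines n S \<Phi> K"
  shows "n_determined n K"
proof -
  have sc: "second_countable S" and hd: "Hausdorff_space S"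
    using assms(3) by (auto simp: determines_def)
  obtain c :: "'b \<Rightarrow> nat set" where c: "inj_on c (topspace S)"
    using second_countable_Hausdorff_inj[OF sc hd] .
  define d where "d = inv_into (topspace S) c"
  define S' where "S' = pullback_topology (c ` topspace S) d S"
  define \<Psi> where "\<Psi> = \<Phi> \<circ> d"
  have dc: "d (c x) = x" if "x \<in> topspace S" for x
    using that c by (simp add: d_def)
  have pb: "d -` U \<inter> c ` topspace S = c ` U" if "U \<subseteq> topspace S" for U
    using that by (auto simp: dc subset_iff)
  have opS': "openin S' W \<longleftrightarrow> (\<exists>U. openin S U \<and> W = c ` U)" for W
    unfolding S'_def openin_pullback_topology by (metis openin_subset pb)
  have tS': "topspace S' = c ` topspace S"
    unfolding S'_def topspace_pullback_topology using pb by blast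
  have "homeomorphic_map S S' c"
  proof (rule bijective_open_imp_homeomorphic_map)
    show "continuous_map S S' c"
      unfolding continuous_map_def
    proof (intro conjI allI impI)
      show "c \<in> topspace S \<rightarrow> topspace S'" using tS' by auto
      fix W assume "openin S' W"
      then obtain U where U: "openin S U" "W = c ` U" using opS' by auto
      then have "{x \<in> topspace S. c x \<in> W} = U"
        using openin_subset[OF U(1)] c by (auto simp: inj_on_def)
      with U show "openin S {x \<in> topspace S. c x \<in> W}" by simp
    qed
    show "open_map S S' c" using opS' by (auto simp: open_map_def)
  qed (use tS' c in auto)
  then have "S homeomorphic_space S'" using homeomorphic_map_imp_homeomorphic_space by blast
  then have "second_countable S'" "Hausdorff_space S'"
    using sc hd homeomorphic_space_second_countability homeomorphic_Hausdorff_space by blast+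
  moreover have "usc_set_valued S' K \<Psi>"
    unfolding usc_set_valued_def
  proof (intro conjI ballI allI impI)
    fix s assume "s \<in> topspace S'"
    then show "\<Psi> s \<subseteq> topspace K"
      using assms(3) tS' by (auto simp: determines_def usc_set_valued_def \<Psi>_def dc)
  next
    fix V assume "openin K V"
    then have "openin S {s \<in> topspace S. \<Phi> s \<subseteq> V}"
      using assms(3) by (auto simp: determines_def usc_set_valued_def)
    moreover have "{s \<in> topspace S'. \<Psi> s \<subseteq> V} = c ` {s \<in> topspace S. \<Phi> s \<subseteq> V}"
      unfolding tS' \<Psi>_def by (auto simp: dc)
    ultimately show "openin S' {s \<in> topspace S'. \<Psi> s \<subseteq> V}" using opS' by metis
  qed
  ultimately have "determines n S' \<Psi> K"
    using assms(3) tS' by (auto simp: determines_def \<Psi>_def dc)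
  then show ?thesis using assms by (auto simp: n_determined_def)
qed


section \<open>The one-point compactification of a tree\<close>

text \<open>
  The statement uses \<^const>\<open>Alexandroff_compactification\<close>, whose point at infinity is \<open>None\<close>. The
  last lemma of this section confirms that its topology is the one with basic neighbourhoods
  \<open>\<alpha>T - \<Union>\<^sub>i [0, t\<^sub>i]\<close> of infinity.
\<close>

lemma tree_root_least:
  assumes "is_tree T"
  shows "tree_root T \<in> T" "t \<in> T \<Longrightarrow> tree_root T \<le> t"
proof -
  obtain r where "r \<in> T" "\<forall>t\<in>T. r \<le> t" using assms by (auto simp: is_tree_def)
  then have "tree_root T = r" unfolding tree_root_def by (intro Least_equality) auto
  with \<open>r \<in> T\<close> \<open>\<forall>t\<in>T. r \<le> t\<close> show "tree_root T \<in> T" "t \<in> T \<Longrightarrow> tree_root T \<le> t" by auto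
qed

lemma topspace_tree_topology:
  assumes "is_tree T"
  shows "topspace (tree_topology T) = T"
proof -
  have "x \<in> \<Union>(insert {tree_root T} {{x \<in> T. s < x \<and> x \<le> t} | s t. s \<in> T \<and> t \<in> T})" if "x \<in> T" for x
  proof (cases "x = tree_root T")
    case False
    then have "tree_root T < x" using tree_root_least(2)[OF assms that] by auto
    then show ?thesis using that tree_root_least(1)[OF assms] by blast
  qed auto
  then show ?thesis
    unfolding tree_topology_def topology_generated_by_topspace
    using tree_root_least(1)[OF assms] by auto
qed

lemma is_tree_linear:
  assumes "is_tree T" "t \<in> T" "x \<in> T" "y \<in> T" "x < t" "y < t"
  shows "x \<le> y \<or> y \<le> x"
proof -
  have "linear_order_on {x \<in> T. x < t} {(x, y). x \<in> T \<and> y \<in> T \<and> x < t \<and> y < t \<and> x \<le> y}"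
    using assms(1,2) by (auto simp: is_tree_def well_order_on_def)
  then show ?thesis using assms by (auto simp: linear_order_on_def total_on_def)
qed

lemma is_tree_less_induct [consumes 2, case_names less]:
  assumes "is_tree T" "t \<in> T"
    and step: "\<And>t. t \<in> T \<Longrightarrow> (\<And>s. s \<in> T \<Longrightarrow> s < t \<Longrightarrow> P s) \<Longrightarrow> P t"
  shows "P t"
proof (rule step[OF assms(2)])
  let ?r = "{(x, y). x \<in> T \<and> y \<in> T \<and> x < t \<and> y < t \<and> x \<le> y}"
  have wf: "wf (?r - Id)"
    using assms(1,2) by (auto simp: is_tree_def well_order_on_def)
  fix s assume "s \<in> T" "s < t"
  with wf show "P s"
  proof (induction s rule: wf_induct_rule)
    case (less s)
    show ?case
    proof (rule step[OF \<open>s \<in> T\<close>])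
      fix u assume "u \<in> T" "u < s"
      with less.prems have "(u, s) \<in> ?r - Id" "u < t" by auto
      then show "P u" using less.IH \<open>u \<in> T\<close> by blast
    qed
  qed
qed

lemma openin_tree_topology:
  assumes "is_tree T"
  shows "openin (tree_topology T) U \<longleftrightarrow>
           U \<subseteq> T \<and> (\<forall>t\<in>U. t \<noteq> tree_root T \<longrightarrow> (\<exists>s\<in>T. s < t \<and> {x \<in> T. s < x \<and> x \<le> t} \<subseteq> U))"
    (is "?L \<longleftrightarrow> ?R")
proof
  let ?G = "insert {tree_root T} {{x \<in> T. s < x \<and> x \<le> t} | s t. s \<in> T \<and> t \<in> T}"
  assume ?L
  have "generate_topology_on ?G U"
    using \<open>?L\<close> unfolding tree_topology_def by (simp add: openin_topology_generated_by_iff)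
  then have "\<forall>t\<in>U. t \<noteq> tree_root T \<longrightarrow> (\<exists>s\<in>T. s < t \<and> {x \<in> T. s < x \<and> x \<le> t} \<subseteq> U)"
  proof induction
    case (Int a b)
    show ?case
    proof (intro ballI impI)
      fix t assume t: "t \<in> a \<inter> b" "t \<noteq> tree_root T"
      obtain p where p: "p \<in> T" "p < t" "{x \<in> T. p < x \<and> x \<le> t} \<subseteq> a" using Int t by blast
      obtain q where q: "q \<in> T" "q < t" "{x \<in> T. q < x \<and> x \<le> t} \<subseteq> b" using Int t by blast
      have "openin (tree_topology T) a"
        unfolding tree_topology_def openin_topology_generated_by_iff by (rule Int.hyps(1))
      then have "t \<in> T"
        using t(1) openin_subset topspace_tree_topology[OF assms] by blast
      then have "p \<le> q \<or> q \<le> p" using is_tree_linear[OF assms, of t p q] p q by auto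
      then show "\<exists>s\<in>T. s < t \<and> {x \<in> T. s < x \<and> x \<le> t} \<subseteq> a \<inter> b"
      proof
        assume "p \<le> q"
        then have "{x \<in> T. q < x \<and> x \<le> t} \<subseteq> a \<inter> b" using p q by auto
        then show ?thesis using q by blast
      next
        assume "q \<le> p"
        then have "{x \<in> T. p < x \<and> x \<le> t} \<subseteq> a \<inter> b" using p q by auto
        then show ?thesis using p by blast
      qed
    qed
  next
    case (UN K)
    show ?case
    proof (intro ballI impI)
      fix t assume t: "t \<in> \<Union>K" "t \<noteq> tree_root T"
      then obtain k where k: "k \<in> K" "t \<in> k" by blast
      then obtain s where s: "s \<in> T" "s < t" "{x \<in> T. s < x \<and> x \<le> t} \<subseteq> k"
        using UN.IH[OF k(1)] t(2) by blast
      then have "{x \<in> T. s < x \<and> x \<le> t} \<subseteq> \<Union>K" using k(1) by blast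
      with s show "\<exists>s\<in>T. s < t \<and> {x \<in> T. s < x \<and> x \<le> t} \<subseteq> \<Union>K" by blast
    qed
  next
    case (Basis g)
    then consider "g = {tree_root T}" | s u where "s \<in> T" "u \<in> T" "g = {x \<in> T. s < x \<and> x \<le> u}"
      by blast
    then show ?case
    proof cases
      case 2
      have "{x \<in> T. s < x \<and> x \<le> t} \<subseteq> g" if "t \<in> g" for t using that 2 by auto
      then show ?thesis using 2 by blast
    qed auto
  qed auto
  then show ?R using openin_subset[OF \<open>?L\<close>] topspace_tree_topology[OF assms] by auto
next
  assume R: ?R
  show ?L
  proof (subst openin_subopen, intro ballI)
    fix t assume "t \<in> U"
    show "\<exists>V. openin (tree_topology T) V \<and> t \<in> V \<and> V \<subseteq> U"
    proof (cases "t = tree_root T")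
      case True
      then have "openin (tree_topology T) {t}"
        unfolding tree_topology_def by (intro topology_generated_by_Basis) auto
      then show ?thesis using \<open>t \<in> U\<close> by blast
    next
      case False
      then obtain s where s: "s \<in> T" "s < t" "{x \<in> T. s < x \<and> x \<le> t} \<subseteq> U" using R \<open>t \<in> U\<close> by blast
      moreover have "t \<in> T" using R \<open>t \<in> U\<close> by auto
      ultimately have "openin (tree_topology T) {x \<in> T. s < x \<and> x \<le> t}"
        unfolding tree_topology_def by (intro topology_generated_by_Basis) auto
      with s \<open>t \<in> T\<close> show ?thesis by blast
    qed
  qed
qed

lemma openin_tree_initial:
  assumes "is_tree T" "t \<in> T"
  shows "openin (tree_topology T) {x \<in> T. x \<le> t}"
  unfolding openin_tree_topology[OF assms(1)]
proof (intro conjI ballI impI)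
  fix x assume x: "x \<in> {x \<in> T. x \<le> t}" "x \<noteq> tree_root T"
  then have "tree_root T < x" using tree_root_least(2)[OF assms(1), of x] by auto
  then show "\<exists>s\<in>T. s < x \<and> {y \<in> T. s < y \<and> y \<le> x} \<subseteq> {x \<in> T. x \<le> t}"
    using tree_root_least(1)[OF assms(1)] x by force
qed auto

lemma closedin_tree_initial:
  assumes "is_tree T" "t \<in> T"
  shows "closedin (tree_topology T) {x \<in> T. x \<le> t}"
proof -
  have "openin (tree_topology T) (T - {x \<in> T. x \<le> t})"
    unfolding openin_tree_topology[OF assms(1)]
  proof (intro conjI ballI impI)
    fix x assume "x \<in> T - {x \<in> T. x \<le> t}" "x \<noteq> tree_root T"
    then have x: "x \<in> T" "\<not> x \<le> t" by auto
    then obtain m where m: "m \<in> T" "m \<le> x" "m \<le> t" "\<forall>y\<in>T. y \<le> x \<and> y \<le> t \<longrightarrow> y \<le> m"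
      using assms unfolding is_tree_def by blast
    have "m < x" using m x by auto
    moreover have "{y \<in> T. m < y \<and> y \<le> x} \<subseteq> T - {x \<in> T. x \<le> t}" using m(4) by (auto dest: leD)
    ultimately show "\<exists>s\<in>T. s < x \<and> {y \<in> T. s < y \<and> y \<le> x} \<subseteq> T - {x \<in> T. x \<le> t}"
      using m(1) by blast
  qed auto
  then show ?thesis unfolding closedin_def topspace_tree_topology[OF assms(1)] by auto
qed

lemma compactin_tree_initial:
  assumes "is_tree T" "t \<in> T"
  shows "compactin (tree_topology T) {x \<in> T. x \<le> t}"
  using assms
proof (induction rule: is_tree_less_induct)
  case (less t)
  show ?case
    unfolding compactin_def topspace_tree_topology[OF assms(1)]
  proof (intro conjI allI impI)
    fix \<U> assume \<U>: "Ball \<U> (openin (tree_topology T)) \<and> {x \<in> T. x \<le> t} \<subseteq> \<Union> \<U>"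
    then obtain U where U: "U \<in> \<U>" "t \<in> U" "openin (tree_topology T) U" using less.hyps by auto
    show "\<exists>\<F>. finite \<F> \<and> \<F> \<subseteq> \<U> \<and> {x \<in> T. x \<le> t} \<subseteq> \<Union> \<F>"
    proof (cases "t = tree_root T")
      case True
      then have "{x \<in> T. x \<le> t} = {t}" 
        using tree_root_least[OF assms(1)] less.hyps by (auto intro: antisym)
      then show ?thesis using U by (intro exI[of _ "{U}"]) auto
    next
      case False
      then obtain s where s: "s \<in> T" "s < t" "{x \<in> T. s < x \<and> x \<le> t} \<subseteq> U"
        using U openin_tree_topology[OF assms(1)] by blast
      have "{x \<in> T. x \<le> s} \<subseteq> \<Union> \<U>" using \<U> s(2) by fastforce
      then obtain \<F> where \<F>: "finite \<F>" "\<F> \<subseteq> \<U>" "{x \<in> T. x \<le> s} \<subseteq> \<Union> \<F>"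
        using less.IH[OF s(1,2)] \<U> unfolding compactin_def by blast
      have "{x \<in> T. x \<le> t} \<subseteq> {x \<in> T. x \<le> s} \<union> {x \<in> T. s < x \<and> x \<le> t}"
      proof
        fix x assume "x \<in> {x \<in> T. x \<le> t}"
        moreover from this have "x \<le> s \<or> s \<le> x"
          using is_tree_linear[OF assms(1) less.hyps _ s(1) _ s(2), of x] s(2) by (cases "x = t") auto
        ultimately show "x \<in> {x \<in> T. x \<le> s} \<union> {x \<in> T. s < x \<and> x \<le> t}" by auto
      qed
      then have "{x \<in> T. x \<le> t} \<subseteq> \<Union> (insert U \<F>)" using s(3) \<F>(3) by blast
      then show ?thesis using \<F> U(1) by (intro exI[of _ "insert U \<F>"]) auto
    qed
  qed auto
qed

lemma openin_Alexandroff_tree: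
  assumes "is_tree T"
  shows "openin (Alexandroff_compactification (tree_topology T)) U \<longleftrightarrow>
           U \<subseteq> insert None (Some ` T) \<and>
           openin (tree_topology T) {x. Some x \<in> U} \<and>
           (None \<in> U \<longrightarrow> (\<exists>F. finite F \<and> F \<subseteq> T \<and>
              insert None (Some ` T) - Some ` (\<Union>t\<in>F. {x \<in> T. x \<le> t}) \<subseteq> U))"
    (is "?L \<longleftrightarrow> ?R")
proof
  assume L: ?L
  have sub: "U \<subseteq> insert None (Some ` T)"
    using openin_subset[OF L] by (simp add: topspace_tree_topology[OF assms])
  have "continuous_map (tree_topology T) (Alexandroff_compactification (tree_topology T)) Some"
    by (rule continuous_map_Some)
  then have "openin (tree_topology T) {x \<in> T. Some x \<in> U}"
    using L topspace_tree_topology[OF assms] unfolding continuous_map_def by auto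
  moreover have "{x \<in> T. Some x \<in> U} = {x. Some x \<in> U}" using sub by auto
  moreover have "\<exists>F. finite F \<and> F \<subseteq> T \<and>
              insert None (Some ` T) - Some ` (\<Union>t\<in>F. {x \<in> T. x \<le> t}) \<subseteq> U" if none: "None \<in> U"
  proof -
    obtain C where C: "compactin (tree_topology T) C" "U = insert None (Some ` (T - C))"
      using L none topspace_tree_topology[OF assms] by (auto simp: openin_Alexandroff_compactification)
    have "C \<subseteq> T" using C(1) topspace_tree_topology[OF assms] compactin_subset_topspace by blast
    then have "C \<subseteq> \<Union> ((\<lambda>t. {x \<in> T. x \<le> t}) ` T)" by auto
    then obtain \<F> where \<F>: "finite \<F>" "\<F> \<subseteq> (\<lambda>t. {x \<in> T. x \<le> t}) ` T" "C \<subseteq> \<Union> \<F>"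
      using compactinD[OF C(1), of "(\<lambda>t. {x \<in> T. x \<le> t}) ` T"] openin_tree_initial[OF assms] by auto
    then obtain F where F: "F \<subseteq> T" "finite F" "\<F> = (\<lambda>t. {x \<in> T. x \<le> t}) ` F"
      using finite_subset_image[OF \<F>(1,2)] by auto
    have "C \<subseteq> (\<Union>t\<in>F. {x \<in> T. x \<le> t})" using \<F>(3) unfolding F(3) .
    then have "insert None (Some ` T) - Some ` (\<Union>t\<in>F. {x \<in> T. x \<le> t}) \<subseteq> U"
      unfolding C(2) by blast
    with F(1,2) show ?thesis by metis
  qed
  ultimately show ?R using sub by auto
next
  assume R: ?R
  let ?V = "{x. Some x \<in> U}"
  have VT: "?V \<subseteq> T" using R by auto
  show ?L
  proof (cases "None \<in> U")
    case False
    then have "U = Some ` ?V" by (auto simp: image_iff) (metis not_None_eq)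
    then show ?thesis using R openin_Alexandroff_compactification_image_Some by metis
  next
    case True
    then obtain F where F: "finite F" "F \<subseteq> T"
        "insert None (Some ` T) - Some ` (\<Union>t\<in>F. {x \<in> T. x \<le> t}) \<subseteq> U" using R by blast
    have "closedin (tree_topology T) (T - ?V)"
      using R topspace_tree_topology[OF assms] by (metis closedin_diff closedin_topspace)
    moreover have "compactin (tree_topology T) (\<Union>t\<in>F. {x \<in> T. x \<le> t})"
      using F(1,2) compactin_tree_initial[OF assms] by (intro compactin_Union) auto
    moreover have "T - ?V \<subseteq> (\<Union>t\<in>F. {x \<in> T. x \<le> t})" using F(3) by auto
    ultimately have "compactin (tree_topology T) (T - ?V)" by (meson closed_compactin)
    moreover have "U = insert None (Some ` ?V)" using True by (auto simp: image_iff) (metis not_None_eq)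
    moreover have "T - (T - ?V) = ?V" using VT by auto
    ultimately show ?thesis
      using \<open>closedin _ (T - ?V)\<close> topspace_tree_topology[OF assms]
      unfolding openin_Alexandroff_compactification by metis
  qed
qed

end

theory Submission
  imports Defs
begin

section \<open>Determined spaces from countable families of sets\<close>

text \<open>Suppose \<open>\<Phi>\<close> 2-determines \<alpha>T. Coding a point by some s with the
  point in \<open>\<Phi> s\<close>, together with its index there, bounds |T|
  (\<open>determines_lepoll\<close>). If all [0,y] are countable, then all but countably many t in T
  lie only in sets {t, \<infinity>}. Such a set misses the clopen [0,y] whenever t is not below y,
  so upper semicontinuity yields countably many sets, one of which contains t and misses [0,y]
  (\<open>determined_separating_family\<close>). The up-closures of these sets separate s < t, and a
  weighted sum of their indicators embeds T in the reals (\<open>embeddable_in_real_family\<close>).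
  Countability of [0,x] follows by induction from the same argument with x in place of \<infinity>
  (\<open>determined_tree_countable_initial\<close>).

  Conversely, put \<open>\<Phi> t\<close> = {t, \<infinity>} on T itself, retopologised by countably
  many sets and their complements (\<open>n_determined_family\<close>). These sets are rational cuts
  of the embedding f and the bits of codes of points of T by sets of naturals. Finitely many of them
  must separate t from each of the finitely many [0,u] omitted by a neighbourhood of \<infinity>,
  except for points near t.\<close>

lemma second_countable_euclidean:
  "second_countable (euclidean :: 'a::second_countable_topology topology)"
proof -
  obtain \<B> :: "'a set set" where "countable \<B>" "\<And>C. C \<in> \<B> \<Longrightarrow> open C"
      "\<And>U. open U \<Longrightarrow> \<exists>\<U>. \<U> \<subseteq> \<B> \<and> U = \<Union>\<U>"
    using univ_second_countable by metis
  then show ?thesis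
    unfolding second_countable_def open_openin[symmetric]
    by (intro exI[of _ \<B>]) (metis Union_iff Union_upper subset_iff)
qed

text \<open>The space \<open>S\<close> consists of the 0-1 membership sequences of points of
  \<open>X\<close> in the countably many sets \<open>B i\<close>, inside a countable power of the
  reals. By \<open>sep\<close> a point is recovered from its sequence, and \<open>usc\<close> says
  that finitely many coordinates control \<open>\<Phi>\<close>.\<close>

lemma n_determined_family:
  fixes B :: "'i::countable \<Rightarrow> 'b set"
  assumes "compact_space K" "Hausdorff_space K"
    and sep: "\<And>x y. x \<in> X \<Longrightarrow> y \<in> X \<Longrightarrow> (\<And>i. x \<in> B i \<longleftrightarrow> y \<in> B i) \<Longrightarrow> x = y"
    and val: "\<And>x. x \<in> X \<Longrightarrow> finite (\<Phi> x) \<and> card (\<Phi> x) \<le> n"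
    and cov: "topspace K = (\<Union>x\<in>X. \<Phi> x)"
    and usc: "\<And>x V. x \<in> X \<Longrightarrow> openin K V \<Longrightarrow> \<Phi> x \<subseteq> V \<Longrightarrow>
       \<exists>I. finite I \<and> (\<forall>y\<in>X. (\<forall>i\<in>I. y \<in> B i \<longleftrightarrow> x \<in> B i) \<longrightarrow> \<Phi> y \<subseteq> V)"
  shows "n_determined n K"
proof -
  define \<phi> :: "'b \<Rightarrow> 'i \<Rightarrow> real" where "\<phi> x i = indicator (B i) x" for x i
  have eq: "\<phi> x i = \<phi> y i \<longleftrightarrow> (x \<in> B i \<longleftrightarrow> y \<in> B i)" for x y i
    by (auto simp: \<phi>_def indicator_def)
  have inj: "inj_on \<phi> X"
    by (intro inj_onI sep) (auto simp: eq[symmetric])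
  define S where "S = subtopology euclidean (\<phi> ` X)"
  define \<Psi> where "\<Psi> = \<Phi> \<circ> inv_into X \<phi>"
  have \<Psi>: "\<Psi> (\<phi> x) = \<Phi> x" if "x \<in> X" for x
    using that inj by (simp add: \<Psi>_def)
  have tS: "topspace S = \<phi> ` X" by (simp add: S_def)
  have "second_countable S"
    unfolding S_def by (intro second_countable_subtopology second_countable_euclidean)
  moreover have "Hausdorff_space S"
    unfolding S_def by (intro Hausdorff_space_subtopology) simp
  moreover have "usc_set_valued S K \<Psi>"
    unfolding usc_set_valued_def
  proof (intro conjI ballI allI impI)
    fix s assume "s \<in> topspace S"
    then show "\<Psi> s \<subseteq> topspace K" using cov by (auto simp: tS \<Psi>)
  next
    fix V assume V: "openin K V"
    show "openin S {s \<in> topspace S. \<Psi> s \<subseteq> V}"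
    proof (subst openin_subopen, intro ballI)
      fix s assume "s \<in> {s \<in> topspace S. \<Psi> s \<subseteq> V}"
      then obtain x where x: "x \<in> X" "s = \<phi> x" "\<Phi> x \<subseteq> V" by (auto simp: tS \<Psi>)
      then obtain I where I: "finite I" "\<And>y. y \<in> X \<Longrightarrow> (\<forall>i\<in>I. y \<in> B i \<longleftrightarrow> x \<in> B i) \<Longrightarrow> \<Phi> y \<subseteq> V"
        using usc[OF x(1) V x(3)] by auto
      \<comment> \<open>Coordinates are 0 or 1, so distance below 1 forces equality on
        \<open>I\<close>.\<close>
      define G where "G = (\<Inter>i\<in>I. (\<lambda>g. g i) -` ball (\<phi> x i) 1)"
      have "open ((\<lambda>g :: 'i \<Rightarrow> real. g i) -` ball (\<phi> x i) 1)" for i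
        by (intro open_vimage continuous_on_product_coordinates) auto
      then have "open G" unfolding G_def using I(1) by blast
      then have "openin S (G \<inter> \<phi> ` X)" unfolding S_def by (auto simp: openin_open)
      moreover have "s \<in> G \<inter> \<phi> ` X" using x by (auto simp: G_def)
      moreover have "G \<inter> \<phi> ` X \<subseteq> {s \<in> topspace S. \<Psi> s \<subseteq> V}"
      proof
        fix g assume "g \<in> G \<inter> \<phi> ` X"
        then obtain y where y: "y \<in> X" "g = \<phi> y" "\<phi> y \<in> G" by auto
        have "y \<in> B i \<longleftrightarrow> x \<in> B i" if "i \<in> I" for i
        proof -
          have "dist (\<phi> x i) (\<phi> y i) < 1" using y(3) that by (auto simp: G_def)
          then show ?thesis by (cases "x \<in> B i"; cases "y \<in> B i") (auto simp: \<phi>_def)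
        qed
        then show "g \<in> {s \<in> topspace S. \<Psi> s \<subseteq> V}" using I(2) y by (auto simp: tS \<Psi>)
      qed
      ultimately show "\<exists>W. openin S W \<and> s \<in> W \<and> W \<subseteq> {s \<in> topspace S. \<Psi> s \<subseteq> V}" by blast
    qed
  qed
  ultimately have "determines n S \<Psi> K"
    using val cov by (auto simp: determines_def tS \<Psi>)
  with assms(1,2) show ?thesis by (rule n_determinedI)
qed

text \<open>The set \<open>\<sigma> x\<close> and the index of x in the finite set
  \<open>\<Phi> (\<sigma> x)\<close> determine x; both are packed into one set of naturals via
  \<open>nat + nat\<close>.\<close>

lemma determines_lepoll:
  fixes S :: "nat set topology"
  assumes "determines n S \<Phi> K"
  shows "topspace K \<lesssim> Pow (UNIV :: nat set)"
proof -
  have fin: "finite (\<Phi> s)" if "s \<in> topspace S" for s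
    using assms that by (auto simp: determines_def)
  have "\<forall>x\<in>topspace K. \<exists>s\<in>topspace S. x \<in> \<Phi> s" using assms by (auto simp: determines_def)
  then obtain \<sigma> where \<sigma>: "\<And>x. x \<in> topspace K \<Longrightarrow> \<sigma> x \<in> topspace S \<and> x \<in> \<Phi> (\<sigma> x)" by metis
  define h :: "_ \<Rightarrow> nat set" where
    "h x = (\<lambda>k. to_nat (Inl k :: nat + nat)) ` \<sigma> x \<union> {to_nat (Inr (to_nat_on (\<Phi> (\<sigma> x)) x) :: nat + nat)}" for x
  have "inj_on h (topspace K)"
  proof (rule inj_onI)
    fix x y assume xy: "x \<in> topspace K" "y \<in> topspace K" "h x = h y"
    have dec: "\<sigma> z = {n. to_nat (Inl n :: nat + nat) \<in> h z}"
      "{n. to_nat (Inr n :: nat + nat) \<in> h z} = {to_nat_on (\<Phi> (\<sigma> z)) z}" for z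
      unfolding h_def by auto
    have "\<sigma> x = \<sigma> y" using dec(1)[of x] dec(1)[of y] xy(3) by simp
    moreover have "to_nat_on (\<Phi> (\<sigma> x)) x = to_nat_on (\<Phi> (\<sigma> y)) y"
      using dec(2)[of x] dec(2)[of y] xy(3) by simp
    ultimately show "x = y"
      using \<sigma> xy(1,2) countable_finite[OF fin] by (metis inj_on_to_nat_on inj_onD)
  qed
  then show ?thesis unfolding lepoll_def by auto
qed

text \<open>
  A point \<open>s\<close> with \<open>e \<notin> \<Phi> s\<close> confines \<open>\<Phi> s \<inter> L\<close> to finitely many of the sets \<open>D y\<close>; by second
  countability, all these \<open>s\<close> together reach only countably many points of \<open>L\<close>. Any other point \<open>t\<close>
  of \<open>L\<close> is attained by a set \<open>\<Phi> s = {t, e}\<close>, which avoids every \<open>D y\<close> not containing \<open>t\<close>.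
\<close>

lemma determined_separating_family:
  assumes det: "determines 2 S \<Phi> K"
    and L: "L \<subseteq> topspace K" "closedin K (insert e L)" "e \<notin> L"
    and D: "\<And>y. y \<in> L \<Longrightarrow> openin K (D y) \<and> closedin K (D y) \<and> countable (D y)"
      "\<And>y. y \<in> L \<Longrightarrow> y \<in> D y \<and> D y \<subseteq> L"
  obtains \<E> where "countable \<E>"
    "\<And>y t. y \<in> L \<Longrightarrow> t \<in> L \<Longrightarrow> t \<notin> D y \<Longrightarrow> \<exists>E\<in>\<E>. t \<in> E \<and> E \<inter> D y = {}"
proof -
  have usc: "openin S {s \<in> topspace S. \<Phi> s \<subseteq> V}" if "openin K V" for V
    using det that by (auto simp: determines_def usc_set_valued_def)
  have sub: "\<Phi> s \<subseteq> topspace K" "finite (\<Phi> s)" "card (\<Phi> s) \<le> 2" if "s \<in> topspace S" for s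
    using det that by (auto simp: determines_def usc_set_valued_def)
  have cov: "topspace K = (\<Union>s \<in> topspace S. \<Phi> s)" using det by (auto simp: determines_def)
  obtain \<B> where \<B>: "countable \<B>"
      "\<And>V. V \<in> \<B> \<Longrightarrow> openin S V"
      "\<And>U x. openin S U \<Longrightarrow> x \<in> U \<Longrightarrow> \<exists>V \<in> \<B>. x \<in> V \<and> V \<subseteq> U"
    using det unfolding determines_def second_countable_def by metis
  have nbd: "\<exists>B\<in>\<B>. s \<in> B \<and> \<Union>(\<Phi> ` B) \<subseteq> V" if "s \<in> topspace S" "openin K V" "\<Phi> s \<subseteq> V" for s V
    using \<B>(3)[OF usc[OF that(2)], of s] that by blast
  \<comment> \<open>\<open>C\<close> collects the countable traces on \<open>L\<close> of images of
    basic open sets.\<close>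
  define C where "C = (\<Union>E \<in> {E \<in> (\<lambda>B. L \<inter> \<Union>(\<Phi> ` B)) ` \<B>. countable E}. E)"
  have C: "countable C"
    unfolding C_def using \<B>(1) by (intro countable_UN countable_Collect countable_image) simp_all
  have inC: "\<Phi> s \<inter> L \<subseteq> C" if s: "s \<in> topspace S" "e \<notin> \<Phi> s" for s
  proof -
    \<comment> \<open>As e is not in \<open>\<Phi> s\<close>, this open set contains
      \<open>\<Phi> s\<close>; its trace on \<open>L\<close> is a finite union of countable sets
      \<open>D y\<close>.\<close>
    define V where "V = (topspace K - insert e L) \<union> (\<Union>y\<in>\<Phi> s \<inter> L. D y)"
    have "openin K V" unfolding V_def using L(2) D(1)
      by (intro openin_Un openin_diff openin_Union) auto
    moreover have "\<Phi> s \<subseteq> V" using sub(1)[OF s(1)] s(2) D(2) by (auto simp: V_def)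
    ultimately obtain B where B: "B \<in> \<B>" "s \<in> B" "\<Union>(\<Phi> ` B) \<subseteq> V" using nbd[OF s(1)] by blast
    have "L \<inter> \<Union>(\<Phi> ` B) \<subseteq> (\<Union>y\<in>\<Phi> s \<inter> L. D y)" using B(3) by (auto simp: V_def)
    moreover have "countable (\<Union>y\<in>\<Phi> s \<inter> L. D y)" using D(1) sub(2)[OF s(1)]
      by (intro countable_UN) (auto intro: countable_finite)
    ultimately have "countable (L \<inter> \<Union>(\<Phi> ` B))" by (rule countable_subset)
    then have "L \<inter> \<Union>(\<Phi> ` B) \<subseteq> C" using B(1) unfolding C_def by blast
    then show ?thesis using B(2) by blast
  qed
  show thesis
  proof (rule that[of "(\<lambda>B. \<Union>(\<Phi> ` B)) ` \<B> \<union> (\<lambda>c. {c}) ` C"])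
    show "countable ((\<lambda>B. \<Union>(\<Phi> ` B)) ` \<B> \<union> (\<lambda>c. {c}) ` C)" using \<B>(1) C by simp
    fix y t assume y: "y \<in> L" and t: "t \<in> L" "t \<notin> D y"
    show "\<exists>E\<in>(\<lambda>B. \<Union>(\<Phi> ` B)) ` \<B> \<union> (\<lambda>c. {c}) ` C. t \<in> E \<and> E \<inter> D y = {}"
    proof (cases "t \<in> C")
      case True
      then show ?thesis using t(2) by blast
    next
      case False
      obtain s where s: "s \<in> topspace S" "t \<in> \<Phi> s" using t(1) L(1) cov by blast
      then have "e \<in> \<Phi> s" using inC[OF s(1)] False t(1) by blast
      moreover have "t \<noteq> e" using L(3) t(1) by auto
      \<comment> \<open>The bound 2 enters here: no third point of \<open>\<Phi> s\<close> can fall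
        into \<open>D y\<close>.\<close>
      ultimately have "\<Phi> s = {t, e}"
        using s sub(2,3)[OF s(1)] card_seteq[of "\<Phi> s" "{t, e}"] by auto
      moreover have "e \<notin> D y" using D(2)[OF y] L(3) by auto
      ultimately have "\<Phi> s \<subseteq> topspace K - D y" using sub(1)[OF s(1)] t(2) by auto
      then obtain B where "B \<in> \<B>" "s \<in> B" "\<Union>(\<Phi> ` B) \<subseteq> topspace K - D y"
        using nbd[OF s(1)] D(1)[OF y] by blast
      then show ?thesis using s(2) by blast
    qed
  qed
qed


section \<open>Trees\<close>

lemma is_tree_comparable:
  assumes "is_tree T" "t \<in> T" "x \<in> T" "y \<in> T" "x \<le> t" "y \<le> t"
  shows "x \<le> y \<or> y \<le> x"
  using is_tree_linear[OF assms(1-4)] assms(5,6) by (auto simp: le_less)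

lemma is_tree_not_le:
  assumes "is_tree T" "t \<in> T" "x \<in> T" "y \<in> T" "x \<le> t" "y \<le> t" "\<not> x \<le> y"
  shows "y < x"
  using is_tree_comparable[OF assms(1-6)] assms(7) by (auto simp: less_le_not_le)

lemma is_tree_least:
  assumes T: "is_tree T" "u \<in> T" and A: "A \<subseteq> T" "A \<noteq> {}" "\<And>a. a \<in> A \<Longrightarrow> a \<le> u"
  obtains m where "m \<in> A" "\<And>a. a \<in> A \<Longrightarrow> m \<le> a"
proof -
  have "a \<in> A \<longrightarrow> (\<exists>m\<in>A. \<forall>b\<in>A. m \<le> b)" if "a \<in> T" for a
    using T(1) that
  proof (induction rule: is_tree_less_induct)
    case (less a)
    show ?case
    proof (intro impI, cases "\<forall>b\<in>A. a \<le> b")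
      case False
      assume a: "a \<in> A"
      from False obtain b where "b \<in> A" "\<not> a \<le> b" by auto
      then have "b < a" "b \<in> T" using is_tree_not_le[OF T, of a b] a A by auto
      then show "\<exists>m\<in>A. \<forall>b\<in>A. m \<le> b" using less.IH \<open>b \<in> A\<close> by blast
    qed auto
  qed
  then show thesis using A(1,2) that by blast
qed

text \<open>The immediate successor of s towards t. The gap between s and m is where separating sets
  and rational cuts are later placed.\<close>

lemma is_tree_succ:
  assumes "is_tree T" "s \<in> T" "t \<in> T" "s < t"
  obtains m where "m \<in> T" "s < m" "m \<le> t" "\<And>x. x \<in> T \<Longrightarrow> x \<le> t \<Longrightarrow> s < x \<Longrightarrow> m \<le> x"
proof (rule is_tree_least[OF assms(1,3), of "{x \<in> T. s < x \<and> x \<le> t}"])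
  show "{x \<in> T. s < x \<and> x \<le> t} \<noteq> {}" using assms(3,4) by blast
  fix m assume "m \<in> {x \<in> T. s < x \<and> x \<le> t}" "\<And>a. a \<in> {x \<in> T. s < x \<and> x \<le> t} \<Longrightarrow> m \<le> a"
  then show thesis by (intro that[of m]) simp_all
qed auto

text \<open>Compactness of [0,t] keeps it closed after \<infinity> is added.\<close>

lemma clopen_Alexandroff_tree_initial:
  assumes "is_tree T" "t \<in> T"
  shows "openin (Alexandroff_compactification (tree_topology T)) (Some ` {x \<in> T. x \<le> t})"
    "closedin (Alexandroff_compactification (tree_topology T)) (Some ` {x \<in> T. x \<le> t})"
  using openin_tree_initial[OF assms] closedin_tree_initial[OF assms] compactin_tree_initial[OF assms]
  by simp_all

lemma Hausdorff_Alexandroff_tree: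
  assumes T: "is_tree T"
  shows "Hausdorff_space (Alexandroff_compactification (tree_topology T))" (is "Hausdorff_space ?K")
  unfolding Hausdorff_space_def
proof (intro allI impI)
  fix x y assume xy: "x \<in> topspace ?K \<and> y \<in> topspace ?K \<and> x \<noteq> y"
  then obtain a where a: "a \<in> T" "x = Some a \<and> y \<noteq> x \<or> y = Some a \<and> x \<noteq> y"
    by (auto simp: topspace_tree_topology[OF T])
  \<comment> \<open>Take b to be the other point if it lies below a, and a itself otherwise.\<close>
  have "\<exists>b\<in>T. (x \<in> Some ` {z \<in> T. z \<le> b}) \<noteq> (y \<in> Some ` {z \<in> T. z \<le> b})"
  proof (cases "\<exists>b\<in>T. b < a \<and> (x = Some b \<or> y = Some b)")
    case True
    then show ?thesis using a by (auto simp: less_le_not_le)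
  next
    case False
    then show ?thesis using a xy by (intro bexI[of _ a]) (auto simp: le_less)
  qed
  then obtain t where t: "t \<in> T"
      "x \<in> Some ` {z \<in> T. z \<le> t} \<and> y \<notin> Some ` {z \<in> T. z \<le> t} \<or>
       x \<notin> Some ` {z \<in> T. z \<le> t} \<and> y \<in> Some ` {z \<in> T. z \<le> t}"
    by blast
  let ?D = "Some ` {z \<in> T. z \<le> t}"
  have "openin ?K ?D" "openin ?K (topspace ?K - ?D)"
    using clopen_Alexandroff_tree_initial[OF T t(1)] by blast+
  moreover have "disjnt ?D (topspace ?K - ?D)" "disjnt (topspace ?K - ?D) ?D"
    unfolding disjnt_def by blast+
  ultimately show "\<exists>U V. openin ?K U \<and> openin ?K V \<and> x \<in> U \<and> y \<in> V \<and> disjnt U V"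
    using t(2) xy by (meson DiffI)
qed

text \<open>The sum of the indicators of \<open>U n\<close> with weights 2^-n is nondecreasing along
  T because the sets are upward closed, and it increases strictly from s to t through a separating
  set.\<close>

lemma embeddable_in_real_family:
  fixes U :: "nat \<Rightarrow> 'a::order set"
  assumes up: "\<And>n s t. s \<in> T \<Longrightarrow> t \<in> T \<Longrightarrow> s \<le> t \<Longrightarrow> s \<in> U n \<Longrightarrow> t \<in> U n"
    and sep: "\<And>s t. s \<in> T \<Longrightarrow> t \<in> T \<Longrightarrow> s < t \<Longrightarrow> \<exists>n. s \<notin> U n \<and> t \<in> U n"
  shows "embeddable_in T (UNIV :: real set)"
proof -
  define g :: "'a \<Rightarrow> nat \<Rightarrow> real" where "g t n = indicator (U n) t * (1/2)^n" for t n
  have sum: "summable (g t)" for t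
  proof (rule summable_comparison_test')
    show "summable (\<lambda>n. (1/2 :: real)^n)" by (simp add: summable_geometric)
    show "norm (g t n) \<le> (1/2)^n" if "n \<ge> 0" for n by (simp add: g_def indicator_def)
  qed
  have "suminf (g s) < suminf (g t)" if st: "s \<in> T" "t \<in> T" "s < t" for s t
  proof -
    obtain k where k: "s \<notin> U k" "t \<in> U k" using sep[OF st] by auto
    have "0 < suminf (\<lambda>n. g t n - g s n)"
    proof (rule suminf_pos2)
      show "summable (\<lambda>n. g t n - g s n)" using sum by (intro summable_diff)
      show "0 \<le> g t n - g s n" for n using up[of s t n] st by (auto simp: g_def indicator_def)
      show "0 < g t k - g s k" using k by (simp add: g_def)
    qed
    also have "\<dots> = suminf (g t) - suminf (g s)" using sum by (simp add: suminf_diff)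
    finally show ?thesis by simp
  qed
  then have "strict_mono_on T (\<lambda>t. suminf (g t))" by (auto intro: strict_mono_onI)
  then show ?thesis unfolding embeddable_in_def by blast
qed


section \<open>From determined to embeddable\<close>

text \<open>
  In the induction, \<open>x\<close> plays the role of \<open>\<infinity>\<close> for the chain below it. A separating set which meets
  the chain first in the successor of \<open>t\<close> determines \<open>t\<close>, so the chain is countable.
\<close>

lemma determined_tree_countable_initial:
  assumes T: "is_tree T" and det: "determines 2 S \<Phi> (Alexandroff_compactification (tree_topology T))"
    and x: "x \<in> T"
  shows "countable {y \<in> T. y \<le> x}"
  using T x
proof (induction rule: is_tree_less_induct)
  case (less x)
  let ?K = "Alexandroff_compactification (tree_topology T)"
  let ?D = "\<lambda>y. Some ` {z \<in> T. z \<le> y}"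
  define L where "L = Some ` {y \<in> T. y < x}"
  have ins: "insert (Some x) L = ?D x" using less.hyps by (auto simp: L_def le_less)
  have clo: "closedin ?K (insert (Some x) L)"
    unfolding ins using clopen_Alexandroff_tree_initial[OF T less.hyps] by simp
  obtain \<E> where \<E>: "countable \<E>"
    "\<And>y t. y \<in> L \<Longrightarrow> t \<in> L \<Longrightarrow> t \<notin> ?D (the y) \<Longrightarrow> \<exists>E\<in>\<E>. t \<in> E \<and> E \<inter> ?D (the y) = {}"
  proof (rule determined_separating_family[OF det _ clo, of "\<lambda>y. ?D (the y)"])
    show "L \<subseteq> topspace ?K" using topspace_tree_topology[OF T] by (auto simp: L_def)
    show "Some x \<notin> L" by (auto simp: L_def)
    fix y assume "y \<in> L"
    then obtain z where z: "y = Some z" "z \<in> T" "z < x" by (auto simp: L_def)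
    then show "openin ?K (?D (the y)) \<and> closedin ?K (?D (the y)) \<and> countable (?D (the y))"
      using clopen_Alexandroff_tree_initial[OF T z(2)] less.IH by auto
    show "y \<in> ?D (the y) \<and> ?D (the y) \<subseteq> L" using z by (auto simp: L_def)
  qed blast
  show ?case
  \<comment> \<open>If the chain below x has a largest element, the induction hypothesis suffices.
    Otherwise each t < x has its successor towards x strictly below x.\<close>
  proof (cases "\<exists>t\<in>T. t < x \<and> {y \<in> T. y < x} \<subseteq> {y \<in> T. y \<le> t}")
    case True
    then have "countable {y \<in> T. y < x}" using less.IH by (meson countable_subset)
    then have "countable (insert x {y \<in> T. y < x})" by simp
    then show ?thesis by (rule countable_subset[rotated]) (auto simp: le_less)
  next
    case False
    \<comment> \<open>\<open>u\<close> is the successor of t towards x, and \<open>E\<close>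
      contains it but misses [0,t].\<close>
    define Q where "Q t E u \<longleftrightarrow> E \<in> \<E> \<and> u \<in> T \<and> t < u \<and> u < x \<and> Some u \<in> E \<and> E \<inter> ?D t = {} \<and>
        (\<forall>v\<in>T. v \<le> x \<longrightarrow> t < v \<longrightarrow> u \<le> v)" for t E u
    have "\<exists>E u. Q t E u" if t: "t \<in> T" "t < x" for t
    proof -
      obtain u where u: "u \<in> T" "t < u" "u \<le> x" "\<And>v. v \<in> T \<Longrightarrow> v \<le> x \<Longrightarrow> t < v \<Longrightarrow> u \<le> v"
        using is_tree_succ[OF T t(1) less.hyps t(2)] by blast
      obtain v where v: "v \<in> T" "v < x" "\<not> v \<le> t" using False t by blast
      then have "t < v" using is_tree_not_le[OF T less.hyps, of v t] t by auto
      then have "u < x" using u(4)[OF v(1) less_imp_le[OF v(2)]] v(2) by (simp add: order.strict_trans1)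
      moreover have "Some u \<notin> ?D t" using u(2) by (auto simp: less_le_not_le)
      ultimately obtain E where "E \<in> \<E>" "Some u \<in> E" "E \<inter> ?D t = {}"
        using \<E>(2)[of "Some t" "Some u"] t u(1) by (auto simp: L_def)
      then show ?thesis using u \<open>u < x\<close> unfolding Q_def by (intro exI[of _ E] exI[of _ u]) simp
    qed
    then obtain E u where "\<And>t. t \<in> T \<Longrightarrow> t < x \<Longrightarrow> Q t (E t) (u t)" by metis
    note Eu = this[unfolded Q_def]
    \<comment> \<open>For s < t the successor of s is at most t, so a common set would meet
      [0,t].\<close>
    have no: "E s \<noteq> E t" if st: "s \<in> T" "t \<in> T" "t < x" "s < t" for s t
    proof
      assume "E s = E t"
      moreover have "s < x" using st by auto
      ultimately have "Some (u s) \<in> E t" "u s \<le> t" "u s \<in> T" using Eu[of s] st by auto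
      then show False using Eu[of t] st by blast
    qed
    have "inj_on E {y \<in> T. y < x}"
    proof (rule inj_onI)
      fix s t assume st: "s \<in> {y \<in> T. y < x}" "t \<in> {y \<in> T. y < x}" "E s = E t"
      then have "s \<le> t \<or> t \<le> s" using is_tree_linear[OF T less.hyps, of s t] by auto
      then show "s = t" using no[of s t] no[of t s] st by (auto simp: le_less)
    qed
    moreover have "E ` {y \<in> T. y < x} \<subseteq> \<E>" using Eu by auto
    ultimately have "countable {y \<in> T. y < x}"
      using \<E>(1) by (meson countable_image_inj_on countable_subset)
    then have "countable (insert x {y \<in> T. y < x})" by simp
    then show ?thesis by (rule countable_subset[rotated]) (auto simp: le_less)
  qed
qed

text \<open>The separating family is applied with e = \<infinity> and L = T; its countability
  hypothesis is supplied by \<open>determined_tree_countable_initial\<close>.\<close>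

lemma determined_tree_embeddable:
  fixes T :: "'a::order set"
  assumes T: "is_tree T" and det: "determines 2 S \<Phi> (Alexandroff_compactification (tree_topology T))"
  shows "embeddable_in T (UNIV :: real set)"
proof -
  let ?K = "Alexandroff_compactification (tree_topology T)"
  let ?D = "\<lambda>y. Some ` {z \<in> T. z \<le> y}"
  have clo: "closedin ?K (insert None (Some ` T))"
    using topspace_tree_topology[OF T] by (metis closedin_topspace topspace_Alexandroff_compactification)
  obtain \<E> where \<E>: "countable \<E>"
    "\<And>y t. y \<in> Some ` T \<Longrightarrow> t \<in> Some ` T \<Longrightarrow> t \<notin> ?D (the y) \<Longrightarrow>
        \<exists>E\<in>\<E>. t \<in> E \<and> E \<inter> ?D (the y) = {}"
  proof (rule determined_separating_family[OF det _ clo, of "\<lambda>y. ?D (the y)"])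
    show "Some ` T \<subseteq> topspace ?K" using topspace_tree_topology[OF T] by auto
    fix y assume "y \<in> Some ` T"
    then obtain z where z: "y = Some z" "z \<in> T" by auto
    then show "openin ?K (?D (the y)) \<and> closedin ?K (?D (the y)) \<and> countable (?D (the y))"
      using clopen_Alexandroff_tree_initial[OF T z(2)]
        determined_tree_countable_initial[OF T det z(2)] by auto
    show "y \<in> ?D (the y) \<and> ?D (the y) \<subseteq> Some ` T" using z by auto
  qed auto
  \<comment> \<open>Up-closures: a set missing [0,s] has an up-closure that omits s.\<close>
  define U where "U n = {t. \<exists>y\<in>T. y \<le> t \<and> Some y \<in> from_nat_into \<E> n}" for n
  show ?thesis
  proof (rule embeddable_in_real_family)
    show "t \<in> U n" if "s \<le> t" "s \<in> U n" for n s t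
      using that by (auto simp: U_def intro: order_trans)
    fix s t assume st: "s \<in> T" "t \<in> T" "s < t"
    then obtain E where E: "E \<in> \<E>" "Some t \<in> E" "E \<inter> ?D s = {}"
      using \<E>(2)[of "Some s" "Some t"] by (auto simp: less_le_not_le)
    obtain n where "from_nat_into \<E> n = E" using \<E>(1) E(1) by (metis from_nat_into_to_nat_on)
    then have "s \<notin> U n \<and> t \<in> U n" using E st by (auto simp: U_def)
    then show "\<exists>n. s \<notin> U n \<and> t \<in> U n" ..
  qed
qed


section \<open>From embeddable to determined\<close>

text \<open>
  On the tree itself, take \<open>\<Phi> t = {t, \<infinity>}\<close>. The function \<open>f\<close> separates \<open>t\<close> from the points below and
  above it; points on a branch leaving \<open>[0, t]\<close> are recognised by the first element of the branch at
  which \<open>f\<close> exceeds a suitable rational number.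
\<close>

lemma embeddable_tree_determined:
  fixes T :: "'a::order set"
  assumes T: "is_tree T" and emb: "embeddable_in T (UNIV :: real set)"
    and card: "T \<lesssim> Pow (UNIV :: nat set)"
  shows "n_determined 2 (Alexandroff_compactification (tree_topology T))" (is "n_determined 2 ?K")
proof -
  obtain f :: "'a \<Rightarrow> real" where f: "\<And>s t. s \<in> T \<Longrightarrow> t \<in> T \<Longrightarrow> s < t \<Longrightarrow> f s < f t"
    using emb by (auto simp: embeddable_in_def strict_mono_on_def)
  have fle: "f s \<le> f t" if "s \<in> T" "t \<in> T" "s \<le> t" for s t
    using f[OF that(1,2)] that(3) by (auto simp: le_less)
  obtain j :: "'a \<Rightarrow> nat set" where j: "inj_on j T" using card by (auto simp: lepoll_def)
  \<comment> \<open>unspecified unless \<open>q < f x\<close>\<close>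
  define low where "low q x = (LEAST y. y \<in> T \<and> y \<le> x \<and> real_of_rat q < f y)" for q x
  have lowI: "low q x = m"
    if "m \<in> T" "m \<le> x" "real_of_rat q < f m"
      "\<And>y. y \<in> T \<Longrightarrow> y \<le> x \<Longrightarrow> real_of_rat q < f y \<Longrightarrow> m \<le> y" for q x m
    unfolding low_def using that by (intro Least_equality) auto
  \<comment> \<open>Cuts of f, bits of the code of the first point of [0,x] where f exceeds q, and
    bits of the code of x. The last kind makes the family separate points.\<close>
  define B :: "rat + rat \<times> nat + nat \<Rightarrow> 'a set" where
    "B i = (case i of Inl q \<Rightarrow> {x. real_of_rat q < f x}
       | Inr (Inl (q, k)) \<Rightarrow> {x. k \<in> j (low q x)}
       | Inr (Inr k) \<Rightarrow> {x. k \<in> j x})" for i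
  have B: "x \<in> B (Inl q) \<longleftrightarrow> real_of_rat q < f x"
    "x \<in> B (Inr (Inl (q, k))) \<longleftrightarrow> k \<in> j (low q x)"
    "x \<in> B (Inr (Inr k)) \<longleftrightarrow> k \<in> j x" for x q k
    by (auto simp: B_def)
  \<comment> \<open>Agreement with t on finitely many \<open>B i\<close> forces a point of [0,u]
    into the neighbourhood \<open>W\<close> of t.\<close>
  have sepr: "\<exists>I. finite I \<and> (\<forall>y\<in>T. (\<forall>i\<in>I. y \<in> B i \<longleftrightarrow> t \<in> B i) \<longrightarrow> y \<le> u \<longrightarrow> y \<in> W)"
    if W: "openin (tree_topology T) W" "t \<in> W" and t: "t \<in> T" and u: "u \<in> T" for t u W
  proof (cases "t \<le> u")
    case True
    have "\<exists>I. finite I \<and> (\<forall>y\<in>T. (\<forall>i\<in>I. y \<in> B i \<longleftrightarrow> t \<in> B i) \<longrightarrow> y \<le> u \<longrightarrow> y \<le> t)"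
    proof (cases "t = u")
      case False
      then have "t < u" using True by auto
      then obtain m where m: "m \<in> T" "t < m" "\<And>x. x \<in> T \<Longrightarrow> x \<le> u \<Longrightarrow> t < x \<Longrightarrow> m \<le> x"
        using is_tree_succ[OF T t u] by blast
      \<comment> \<open>A cut in the gap above t: points of [0,u] not below t have f at least
        \<open>f m\<close>.\<close>
      obtain q where q: "f t < real_of_rat q" "real_of_rat q < f m"
        using of_rat_dense[OF f[OF t m(1,2)]] by auto
      have "y \<le> t" if y: "y \<in> T" "y \<le> u" "y \<in> B (Inl q) \<longleftrightarrow> t \<in> B (Inl q)" for y
      proof (rule ccontr)
        assume "\<not> y \<le> t"
        then have "t < y" using is_tree_not_le[OF T u y(1) t y(2) True] by auto
        then have "f m \<le> f y" using m y fle by blast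
        then show False using y(3) q by (simp add: B)
      qed
      then show ?thesis by (intro exI[of _ "{Inl q}"]) auto
    qed (auto intro: exI[of _ "{}"])
    then obtain I where I: "finite I"
      "\<And>y. y \<in> T \<Longrightarrow> (\<forall>i\<in>I. y \<in> B i \<longleftrightarrow> t \<in> B i) \<Longrightarrow> y \<le> u \<Longrightarrow> y \<le> t" by blast
    show ?thesis
    proof (cases "t = tree_root T")
      case True
      then have "y = t" if "y \<in> T" "y \<le> t" for y
        using tree_root_least(2)[OF T that(1)] that(2) by auto
      then show ?thesis using I W(2) by blast
    next
      case False
      then obtain s where s: "s \<in> T" "s < t" "{x \<in> T. s < x \<and> x \<le> t} \<subseteq> W"
        using W openin_tree_topology[OF T] by blast
      \<comment> \<open>This cut excludes [0,s] and leaves (s,t], which lies in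
        \<open>W\<close>.\<close>
      obtain q where q: "f s < real_of_rat q" "real_of_rat q < f t"
        using of_rat_dense[OF f[OF s(1) t s(2)]] by auto
      have "y \<in> W" if y: "y \<in> T" "y \<le> u" "\<forall>i\<in>insert (Inl q) I. y \<in> B i \<longleftrightarrow> t \<in> B i" for y
      proof -
        have yt: "y \<le> t" using I(2) y by auto
        have "real_of_rat q < f y" using y(3) q by (simp add: B)
        then have "\<not> y \<le> s" using fle[OF y(1) s(1)] q by auto
        then have "s < y" using is_tree_not_le[OF T t y(1) s(1)] s(2) yt by auto
        then show ?thesis using s(3) y(1) yt by auto
      qed
      then show ?thesis using I(1) by (intro exI[of _ "insert (Inl q) I"]) auto
    qed
  next
    case False
    have "\<exists>m\<in>T. m \<le> t \<and> m \<le> u \<and> (\<forall>x\<in>T. x \<le> t \<and> x \<le> u \<longrightarrow> x \<le> m)"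
      using conjunct2[OF conjunct2[OF T[unfolded is_tree_def]]] t u by blast
    then obtain m where m: "m \<in> T" "m \<le> t" "m \<le> u" "\<And>x. x \<in> T \<Longrightarrow> x \<le> t \<Longrightarrow> x \<le> u \<Longrightarrow> x \<le> m"
      by blast
    have "m < t" using m False by auto
    then obtain a where a: "a \<in> T" "m < a" "a \<le> t" "\<And>x. x \<in> T \<Longrightarrow> x \<le> t \<Longrightarrow> m < x \<Longrightarrow> a \<le> x"
      using is_tree_succ[OF T m(1) t] by blast
    have au: "\<not> a \<le> u" using m(4)[of a] a by auto
    \<comment> \<open>\<open>m\<close> is the meet of t and u, and \<open>a\<close> the first point
      where the branch to t leaves [0,u]. A cut between them makes \<open>a\<close> the value of
      \<open>low q t\<close>.\<close>
    obtain q where q: "f m < real_of_rat q" "real_of_rat q < f a"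
      using of_rat_dense[OF f[OF m(1) a(1,2)]] by auto
    have lowt: "low q t = a"
    proof (rule lowI)
      fix y assume y: "y \<in> T" "y \<le> t" "real_of_rat q < f y"
      then have "\<not> y \<le> m" using fle[OF y(1) m(1)] q by auto
      then have "m < y" using is_tree_not_le[OF T t y(1) m(1)] y m by auto
      then show "a \<le> y" using a y by auto
    qed (use a q in auto)
    have ft: "real_of_rat q < f t" using fle[OF a(1) t a(3)] q by auto
    show ?thesis
    \<comment> \<open>Here [0,u] is excluded entirely: either f stays at or below q on it, or all
      its points above the cut share one value n of \<open>low q\<close>. As n is in [0,u] and a is
      not, some code bit k tells them apart.\<close>
    proof (cases "real_of_rat q < f u")
      case False
      have "\<not> y \<le> u" if "y \<in> T" "y \<in> B (Inl q) \<longleftrightarrow> t \<in> B (Inl q)" for y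
        using that ft False fle[OF that(1) u] by (auto simp: B)
      then show ?thesis by (intro exI[of _ "{Inl q}"]) auto
    next
      case True
      define A where "A = {x \<in> T. x \<le> u \<and> real_of_rat q < f x}"
      have "A \<subseteq> T" "u \<in> A" "\<And>x. x \<in> A \<Longrightarrow> x \<le> u" using True u by (simp_all add: A_def)
      then obtain n where "n \<in> A" and least: "\<And>x. x \<in> A \<Longrightarrow> n \<le> x"
        using is_tree_least[OF T u, of A] by blast
      then have n: "n \<in> T" "n \<le> u" "real_of_rat q < f n" by (simp_all add: A_def)
      have lowy: "low q y = n" if "y \<in> T" "y \<le> u" "real_of_rat q < f y" for y
        using that n least by (intro lowI) (auto simp: A_def)
      have "j a \<noteq> j n" using j a(1) n(1,2) au by (metis inj_onD)
      then obtain k where k: "\<not> (k \<in> j a \<longleftrightarrow> k \<in> j n)" by blast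
      have "\<not> y \<le> u" if y: "y \<in> T" "\<forall>i\<in>{Inl q, Inr (Inl (q, k))}. y \<in> B i \<longleftrightarrow> t \<in> B i" for y
      proof
        assume "y \<le> u"
        moreover have "real_of_rat q < f y" "k \<in> j (low q y) \<longleftrightarrow> k \<in> j a"
          using y(2) ft by (auto simp: B lowt)
        ultimately show False using lowy y(1) k by auto
      qed
      then show ?thesis by (intro exI[of _ "{Inl q, Inr (Inl (q, k))}"]) auto
    qed
  qed
  show ?thesis
  proof (rule n_determined_family[where X = T and \<Phi> = "\<lambda>t. {Some t, None}" and B = B])
    show "compact_space ?K" by simp
    show "Hausdorff_space ?K" by (rule Hausdorff_Alexandroff_tree[OF T])
    fix x y assume xy: "x \<in> T" "y \<in> T" "\<And>i. x \<in> B i \<longleftrightarrow> y \<in> B i"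
    have "j x = j y" using xy(3)[of "Inr (Inr _)"] by (auto simp: B)
    then show "x = y" using j xy by (auto simp: inj_on_def)
  next
    show "finite {Some x, None} \<and> card {Some x, None} \<le> 2" for x :: 'a
      by simp
    show "topspace ?K = (\<Union>x\<in>T. {Some x, None})"
      using topspace_tree_topology[OF T] tree_root_least(1)[OF T] by auto
  next
    fix t V assume t: "t \<in> T" "openin ?K V" "{Some t, None} \<subseteq> V"
    define W where "W = {x. Some x \<in> V}"
    obtain F where F: "finite F" "F \<subseteq> T" 
        "insert None (Some ` T) - Some ` (\<Union>u\<in>F. {x \<in> T. x \<le> u}) \<subseteq> V"
      using t openin_Alexandroff_tree[OF T] by auto
    have W: "openin (tree_topology T) W" "t \<in> W"
      using t openin_Alexandroff_tree[OF T] by (auto simp: W_def)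
    have "\<forall>u\<in>F. \<exists>I. finite I \<and> (\<forall>y\<in>T. (\<forall>i\<in>I. y \<in> B i \<longleftrightarrow> t \<in> B i) \<longrightarrow> y \<le> u \<longrightarrow> y \<in> W)"
      using sepr[OF W t(1)] F(2) by blast
    then obtain I where I: "\<And>u. u \<in> F \<Longrightarrow> finite (I u)"
      "\<And>u y. u \<in> F \<Longrightarrow> y \<in> T \<Longrightarrow> (\<forall>i\<in>I u. y \<in> B i \<longleftrightarrow> t \<in> B i) \<Longrightarrow> y \<le> u \<Longrightarrow> y \<in> W" by metis
    \<comment> \<open>A point below some u in \<open>F\<close> is forced into \<open>W\<close> by
      \<open>sepr\<close>; any other point already lies in \<open>V\<close>, which contains
      everything outside the sets [0,u].\<close>
    have "{Some y, None} \<subseteq> V" if y: "y \<in> T" "\<forall>i\<in>\<Union>(I ` F). y \<in> B i \<longleftrightarrow> t \<in> B i" for y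
    proof (cases "\<exists>u\<in>F. y \<le> u")
      case True
      then have "y \<in> W" using I(2) y by blast
      then show ?thesis using t(3) by (auto simp: W_def)
    next
      case False
      then show ?thesis using F(3) y(1) t(3) by blast
    qed
    then show "\<exists>I. finite I \<and> (\<forall>y\<in>T. (\<forall>i\<in>I. y \<in> B i \<longleftrightarrow> t \<in> B i) \<longrightarrow> {Some y, None} \<subseteq> V)"
      using F(1) I(1) by (intro exI[of _ "\<Union>(I ` F)"]) auto
  qed
qed

theorem theorem3p1:
  fixes T :: "'a::order set"
  assumes "is_tree T"
  shows "n_determined 2 (Alexandroff_compactification (tree_topology T)) \<longleftrightarrow>
         embeddable_in T (UNIV :: real set) \<and> T \<lesssim> Pow (UNIV :: nat set)"
proof
  assume "n_determined 2 (Alexandroff_compactification (tree_topology T))"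
  then obtain S :: "nat set topology" and \<Phi> where
    det: "determines 2 S \<Phi> (Alexandroff_compactification (tree_topology T))"
    unfolding n_determined_def by blast
  have "T \<lesssim> topspace (Alexandroff_compactification (tree_topology T))"
    using topspace_tree_topology[OF assms] by (auto simp: lepoll_def intro!: exI[of _ Some])
  also have "\<dots> \<lesssim> Pow (UNIV :: nat set)" by (rule determines_lepoll[OF det])
  finally show "embeddable_in T (UNIV :: real set) \<and> T \<lesssim> Pow (UNIV :: nat set)"
    using determined_tree_embeddable[OF assms det] by blast
qed (use embeddable_tree_determined[OF assms] in blast)

end
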